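(* Part 1. Let $\mathcal L$ be a propositional language (a set of sentences built from atomic propositions and closed under $\neg,\wedge,\vee$) and let $C:\mathcal L\times\mathcal L\to[0,1]$ be a (finitely additive) Popper function on $\mathcal L$. Then there exist a NAP space $\langle \Omega,\mathcal U,w\rangle$ with associated NAP function $P$, and an interpretation $a\mapsto \bar a\subseteq\Omega$ of the sentences of $\mathcal L$ (sending logically equivalent sentences to the same set, $\neg,\wedge,\vee$ to complement in $\Omega$, intersection and union, tautologies to $\Omega$ and contradictions to $\emptyset$), such that $P$ is regular and, for all $a,b\in\mathcal L$ with $C(\neg b,b)\neq 1$, we have $\bar b\neq\emptyset$ and $$C(a,b)=\mathrm{st}\Big(\frac{P(\bar a\cap\bar b)}{P(\bar b)}\Big).$$ Part 2. Let $\langle\Omega,\mathcal U,w\rangle$ be a NAP space (on any sample space $\Omega$) whose NAP function $P$ is regular. Then there is a Popper function $C$ on the language whose sentences are the subsets of $\Omega$ (with $\neg,\wedge,\vee$ read as complement, intersection and union) such that for all $A,B\subseteq\Omega$ with $A\neq\emptyset$, $$C(B,A)=\mathrm{st}\Big(\frac{P(B\cap A)}{P(A)}\Big).$$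
   Context: Popper function: for a propositional language $\mathcal L$, a function $C:\mathcal L\times\mathcal L\to[0,1]$ (with $C(a,b)$ read as the probability of $a$ given $b$) such that for all $a,b,d\in\mathcal L$: (1) $C(a,a)=1$; (2) if $C(\neg a,a)\neq 1$ then $C(\cdot,a)$ is a finitely additive probability function on $\mathcal L$ (it is nonnegative, gives value $1$ to tautologies, gives equal values to logically equivalent sentences, and $C(x\vee y,a)=C(x,a)+C(y,a)$ whenever $x\wedge y$ is a contradiction); (3) $C(a\wedge b,d)=C(a,d)\cdot C(b,a\wedge d)$; (4) if $C(a,b)=C(b,a)=1$ then $C(d,a)=C(d,b)$ for all $d\in\mathcal L$. NAP space: a triple $\langle\Omega,\mathcal U,w\rangle$ where $\Omega$ is a set (the sample space), $\Lambda$ is a family of finite subsets of $\Omega$ that is directed under inclusion with $\bigcup\Lambda=\Omega$, $\mathcal U$ is a free ultrafilter on $\Lambda$ that is fine (for every $x\in\Omega$, $\{\lambda\in\Lambda: x\in\lambda\}\in\mathcal U$), and $w:\Omega\to\mathbb R^{+}$ is a strictly positive weight function. Let $\mathbb R^*=\mathbb R^{\Lambda}/\mathcal U$ (functions $\Lambda\to\mathbb R$ modulo agreement on a set in $\mathcal U$), an ordered non-Archimedean field containing $\mathbb R$ via constant functions. For $A\subseteq\Omega$ and $\lambda\in\Lambda$ put $P(A\mid\lambda)=\frac{\sum_{x\in A\cap\lambda}w(x)}{\sum_{x\in\lambda}w(x)}$, and the NAP function is $P(A)=[\lambda\mapsto P(A\mid\lambda)]_{\mathcal U}\in\mathbb R^*$.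 (If $\Omega$ is finite, $P(A)=\sum_{x\in A}w(x)/\sum_{x\in\Omega}w(x)$.) $P$ is regular if $P(A)>0$ for every nonempty $A\subseteq\Omega$. For a finite (i.e. bounded by a real) $r\in\mathbb R^*$, $\mathrm{st}(r)$ is the unique real number infinitely close to $r$.
   Formalization: A Popper function is also required to give equal values under logically equivalent conditions (C(d,a)=C(d,b) if a, b are equivalent), since Part 1 fails for syntactic sentences with (1)–(4) alone; the ultrafilter is required to be free only when Ω is infinite. *)

theory Defs
  imports Complex_Main
begin

section \<open>Languages\<close>

text \<open>
  A language has sentences, connectives and a class of models deciding the sentences; tautology,
  contradiction and logical equivalence are the semantic notions. The same record covers the
  formulas of propositional logic (models: truth assignments to the atoms) and the subsets of
  \<open>\<Omega>\<close> (models: the points of \<open>\<Omega>\<close>).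
\<close>

record ('s, 'v) language =
  sentences :: "'s set"
  lneg :: "'s \<Rightarrow> 's"
  lconj :: "'s \<Rightarrow> 's \<Rightarrow> 's"
  ldisj :: "'s \<Rightarrow> 's \<Rightarrow> 's"
  models :: "'v set"
  sat :: "'v \<Rightarrow> 's \<Rightarrow> bool"

definition tautology :: "('s, 'v) language \<Rightarrow> 's \<Rightarrow> bool" where
  "tautology L a \<longleftrightarrow> (\<forall>v\<in>models L. sat L v a)"

definition contradiction :: "('s, 'v) language \<Rightarrow> 's \<Rightarrow> bool" where
  "contradiction L a \<longleftrightarrow> (\<forall>v\<in>models L. \<not> sat L v a)"

definition log_equiv :: "('s, 'v) language \<Rightarrow> 's \<Rightarrow> 's \<Rightarrow> bool" where
  "log_equiv L a b \<longleftrightarrow> (\<forall>v\<in>models L. sat L v a \<longleftrightarrow> sat L v b)"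

datatype 'p form =
    Atom 'p
  | Neg "'p form"
  | Conj "'p form" "'p form"
  | Disj "'p form" "'p form"

primrec eval :: "('p \<Rightarrow> bool) \<Rightarrow> 'p form \<Rightarrow> bool" where
  "eval v (Atom p) = v p"
| "eval v (Neg a) = (\<not> eval v a)"
| "eval v (Conj a b) = (eval v a \<and> eval v b)"
| "eval v (Disj a b) = (eval v a \<or> eval v b)"

definition closed_forms :: "'p form set \<Rightarrow> bool" where
  "closed_forms S \<longleftrightarrow>
     (\<forall>a\<in>S. Neg a \<in> S) \<and> (\<forall>a\<in>S. \<forall>b\<in>S. Conj a b \<in> S \<and> Disj a b \<in> S)"

definition form_language :: "'p form set \<Rightarrow> ('p form, 'p \<Rightarrow> bool) language" where
  "form_language S =
     \<lparr>sentences = S, lneg = Neg, lconj = Conj, ldisj = Disj, models = UNIV, sat = eval\<rparr>"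

definition subset_language :: "'w set \<Rightarrow> ('w set, 'w) language" where
  "subset_language \<Omega> =
     \<lparr>sentences = Pow \<Omega>, lneg = (\<lambda>A. \<Omega> - A), lconj = (\<inter>), ldisj = (\<union>),
      models = \<Omega>, sat = (\<in>)\<rparr>"


section \<open>Popper functions\<close>

definition fin_add_prob :: "('s, 'v) language \<Rightarrow> ('s \<Rightarrow> real) \<Rightarrow> bool" where
  "fin_add_prob L p \<longleftrightarrow>
     (\<forall>x\<in>sentences L. 0 \<le> p x) \<and>
     (\<forall>x\<in>sentences L. tautology L x \<longrightarrow> p x = 1) \<and>
     (\<forall>x\<in>sentences L. \<forall>y\<in>sentences L. log_equiv L x y \<longrightarrow> p x = p y) \<and>
     (\<forall>x\<in>sentences L. \<forall>y\<in>sentences L.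
        contradiction L (lconj L x y) \<longrightarrow> p (ldisj L x y) = p x + p y)"

text \<open>
  \<open>C a b\<close> is the probability of \<open>a\<close> given \<open>b\<close>. The last clause says that conditions matter only
  up to logical equivalence. It has to be stated: when \<open>C (\<not>a) a = 1\<close> the other clauses leave
  \<open>C\<close> free to depend on the syntactic form of \<open>a\<close>, so that for example all tautologies can be
  abnormal while atoms are not, and then the values given \<open>p\<close>, \<open>q\<close>, \<open>r\<close> need not come from a
  common measure. Given the other clauses, it is equivalent to requiring \<open>C (\<cdot>) a\<close> to be
  constantly \<open>1\<close> whenever \<open>C (\<not>a) a = 1\<close>. In \<open>subset_language\<close> logical equivalence is
  equality, so there the clause is void.
\<close>

definition popper_function :: "('s, 'v) language \<Rightarrow> ('s \<Rightarrow> 's \<Rightarrow> real) \<Rightarrow> bool" where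
  "popper_function L C \<longleftrightarrow>
     (\<forall>a\<in>sentences L. \<forall>b\<in>sentences L. 0 \<le> C a b \<and> C a b \<le> 1) \<and>
     (\<forall>a\<in>sentences L. C a a = 1) \<and>
     (\<forall>a\<in>sentences L. C (lneg L a) a \<noteq> 1 \<longrightarrow> fin_add_prob L (\<lambda>x. C x a)) \<and>
     (\<forall>a\<in>sentences L. \<forall>b\<in>sentences L. \<forall>d\<in>sentences L.
        C (lconj L a b) d = C a d * C b (lconj L a d)) \<and>
     (\<forall>a\<in>sentences L. \<forall>b\<in>sentences L. C a b = 1 \<and> C b a = 1 \<longrightarrow>
        (\<forall>d\<in>sentences L. C d a = C d b)) \<and>
     (\<forall>a\<in>sentences L. \<forall>b\<in>sentences L. log_equiv L a b \<longrightarrow>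
        (\<forall>d\<in>sentences L. C d a = C d b))"


section \<open>Ultrapowers of the reals\<close>

text \<open>
  An ultrafilter on a set \<open>I\<close> is a library filter on the ambient type that contains \<open>I\<close>;
  it is free if its members have no common point.
\<close>

definition ultrafilter_on :: "'i set \<Rightarrow> 'i filter \<Rightarrow> bool" where
  "ultrafilter_on I U \<longleftrightarrow>
     U \<noteq> bot \<and> (\<forall>\<^sub>F i in U. i \<in> I) \<and>
     (\<forall>Q. (\<forall>\<^sub>F i in U. Q i) \<or> (\<forall>\<^sub>F i in U. \<not> Q i))"

definition free_filter :: "'i filter \<Rightarrow> bool" where
  "free_filter U \<longleftrightarrow> (\<forall>i. \<forall>\<^sub>F j in U. j \<noteq> i)"

definition ultra_rel :: "'i filter \<Rightarrow> ('i \<Rightarrow> real) rel" where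
  "ultra_rel U = {(f, g). \<forall>\<^sub>F i in U. f i = g i}"

text \<open>
  A hyperreal is an equivalence class of functions; values outside the index set do not matter
  because the index set belongs to the filter.
\<close>

type_synonym 'i hyper = "('i \<Rightarrow> real) set"

definition hclass :: "'i filter \<Rightarrow> ('i \<Rightarrow> real) \<Rightarrow> 'i hyper" where
  "hclass U f = ultra_rel U `` {f}"

definition hreal :: "'i filter \<Rightarrow> real \<Rightarrow> 'i hyper" where
  "hreal U r = hclass U (\<lambda>_. r)"

definition hminus :: "'i filter \<Rightarrow> 'i hyper \<Rightarrow> 'i hyper \<Rightarrow> 'i hyper" where
  "hminus U X Y = (\<Union>f\<in>X. \<Union>g\<in>Y. hclass U (\<lambda>i. f i - g i))"

definition hdivide :: "'i filter \<Rightarrow> 'i hyper \<Rightarrow> 'i hyper \<Rightarrow> 'i hyper" where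
  "hdivide U X Y = (\<Union>f\<in>X. \<Union>g\<in>Y. hclass U (\<lambda>i. f i / g i))"

definition habs :: "'i filter \<Rightarrow> 'i hyper \<Rightarrow> 'i hyper" where
  "habs U X = (\<Union>f\<in>X. hclass U (\<lambda>i. \<bar>f i\<bar>))"

definition hless :: "'i filter \<Rightarrow> 'i hyper \<Rightarrow> 'i hyper \<Rightarrow> bool" where
  "hless U X Y \<longleftrightarrow> (\<exists>f\<in>X. \<exists>g\<in>Y. \<forall>\<^sub>F i in U. f i < g i)"

definition infinitely_close :: "'i filter \<Rightarrow> 'i hyper \<Rightarrow> 'i hyper \<Rightarrow> bool" where
  "infinitely_close U X Y \<longleftrightarrow>
     (\<forall>\<epsilon>::real. \<epsilon> > 0 \<longrightarrow> hless U (habs U (hminus U X Y)) (hreal U \<epsilon>))"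

definition st :: "'i filter \<Rightarrow> 'i hyper \<Rightarrow> real" where
  "st U X = (THE r. infinitely_close U X (hreal U r))"


section \<open>NAP spaces\<close>

text \<open>
  A finite \<open>\<Omega>\<close> has no free ultrafilter on a family of its subsets. There fineness forces \<open>U\<close> to
  be principal at \<open>\<Omega>\<close>, which yields the elementary formula of lemma \<open>nap_prob_finite\<close> below.
\<close>

definition nap_space ::
  "'w set \<Rightarrow> 'w set set \<Rightarrow> 'w set filter \<Rightarrow> ('w \<Rightarrow> real) \<Rightarrow> bool" where
  "nap_space \<Omega> \<Lambda> U w \<longleftrightarrow>
     (\<forall>l\<in>\<Lambda>. finite l \<and> l \<subseteq> \<Omega>) \<and>
     \<Lambda> \<noteq> {} \<and> (\<forall>k\<in>\<Lambda>. \<forall>l\<in>\<Lambda>. \<exists>m\<in>\<Lambda>. k \<subseteq> m \<and> l \<subseteq> m) \<and>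
     \<Union>\<Lambda> = \<Omega> \<and>
     ultrafilter_on \<Lambda> U \<and>
     (infinite \<Omega> \<longrightarrow> free_filter U) \<and>
     (\<forall>x\<in>\<Omega>. \<forall>\<^sub>F l in U. x \<in> l) \<and>
     (\<forall>x\<in>\<Omega>. 0 < w x)"

definition cond_prob :: "('w \<Rightarrow> real) \<Rightarrow> 'w set \<Rightarrow> 'w set \<Rightarrow> real" where
  "cond_prob w A l = (\<Sum>x\<in>A \<inter> l. w x) / (\<Sum>x\<in>l. w x)"

definition nap_prob :: "'w set filter \<Rightarrow> ('w \<Rightarrow> real) \<Rightarrow> 'w set \<Rightarrow> 'w set hyper" where
  "nap_prob U w A = hclass U (cond_prob w A)"

definition nap_regular :: "'w set \<Rightarrow> 'w set filter \<Rightarrow> ('w \<Rightarrow> real) \<Rightarrow> bool" where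
  "nap_regular \<Omega> U w \<longleftrightarrow>
     (\<forall>A. A \<subseteq> \<Omega> \<and> A \<noteq> {} \<longrightarrow> hless U (hreal U 0) (nap_prob U w A))"

lemma nap_prob_finite:
  assumes nap: "nap_space \<Omega> \<Lambda> U w" and fin: "finite \<Omega>" and A: "A \<subseteq> \<Omega>"
  shows "nap_prob U w A = hreal U ((\<Sum>x\<in>A. w x) / (\<Sum>x\<in>\<Omega>. w x))"
proof -
  have "\<forall>\<^sub>F l in U. \<forall>x\<in>\<Omega>. x \<in> l"
    using nap fin by (simp add: nap_space_def eventually_ball_finite_distrib)
  moreover have "\<forall>\<^sub>F l in U. l \<in> \<Lambda>"
    using nap by (simp add: nap_space_def ultrafilter_on_def)
  ultimately have "\<forall>\<^sub>F l in U. l = \<Omega>"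
    by eventually_elim (use nap in \<open>auto simp: nap_space_def\<close>)
  then have ev: "\<forall>\<^sub>F l in U. cond_prob w A l = (\<Sum>x\<in>A. w x) / (\<Sum>x\<in>\<Omega>. w x)"
    by eventually_elim (use A in \<open>simp add: cond_prob_def Int_absorb2\<close>)
  have "(\<forall>\<^sub>F l in U. cond_prob w A l = g l) \<longleftrightarrow>
        (\<forall>\<^sub>F l in U. (\<Sum>x\<in>A. w x) / (\<Sum>x\<in>\<Omega>. w x) = g l)" for g
    by (rule eventually_subst) (use ev in eventually_elim, simp)
  then show ?thesis
    by (auto simp: nap_prob_def hreal_def hclass_def ultra_rel_def)
qed


section \<open>Interpretations\<close>

definition interpretation_in ::
  "('s, 'v) language \<Rightarrow> 'w set \<Rightarrow> ('s \<Rightarrow> 'w set) \<Rightarrow> bool" where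
  "interpretation_in L \<Omega> J \<longleftrightarrow>
     (\<forall>a\<in>sentences L. J a \<subseteq> \<Omega>) \<and>
     (\<forall>a\<in>sentences L. \<forall>b\<in>sentences L. log_equiv L a b \<longrightarrow> J a = J b) \<and>
     (\<forall>a\<in>sentences L. J (lneg L a) = \<Omega> - J a) \<and>
     (\<forall>a\<in>sentences L. \<forall>b\<in>sentences L. J (lconj L a b) = J a \<inter> J b) \<and>
     (\<forall>a\<in>sentences L. \<forall>b\<in>sentences L. J (ldisj L a b) = J a \<union> J b) \<and>
     (\<forall>a\<in>sentences L. tautology L a \<longrightarrow> J a = \<Omega>) \<and>
     (\<forall>a\<in>sentences L. contradiction L a \<longrightarrow> J a = {})"

end

theory Submission
  imports Defs "HOL-Library.Disjoint_Sets"
begin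

text \<open>
  A NAP space gives a Popper function by taking limits of the finite conditional probabilities along
  the ultrafilter.

  Conversely, let every valuation of the atoms occur infinitely often in the sample space, with all
  weights equal to \<open>1\<close>. On a finite subalgebra a Popper function is a lexicographic sequence of
  probability measures, so it is approximated arbitrarily well by counting in finite sets that
  contain a prescribed finite set and whose cells, layer by layer, have vastly different
  sizes. An ultrafilter that eventually contains every prescribed point and every required
  approximation turns the approximations into equalities of standard parts. Fineness together with
  the positive weights makes the NAP function regular.
\<close>

section \<open>Ultrafilters and standard parts\<close>

text \<open>Zorn's lemma gives a minimal proper filter below \<open>F\<close>. Finer filters are
  smaller in this order, so minimality amounts to the ultrafilter property.\<close>

lemma ultrafilter_below:
  fixes F :: "'i filter"
  assumes "F \<noteq> bot"
  obtains U where "U \<le> F" "U \<noteq> bot" "\<And>Q. (\<forall>\<^sub>F i in U. Q i) \<or> (\<forall>\<^sub>F i in U. \<not> Q i)"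
proof -
  define A where "A = {G. G \<le> F \<and> G \<noteq> bot}"
  have "\<exists>m\<in>A. \<forall>a\<in>A. m \<ge> a \<longrightarrow> a = m"
  proof (rule predicate_Zorn)
    show "partial_order_on A (relation_of (\<ge>) A)"
      by (rule partial_order_on_relation_ofI) auto
  next
    fix K assume "K \<in> Chains (relation_of (\<ge>) A)"
    then have sub: "K \<subseteq> A" and ch: "\<And>x y. x \<in> K \<Longrightarrow> y \<in> K \<Longrightarrow> x \<le> y \<or> y \<le> x"
      by (auto simp: Chains_def relation_of_def)
    show "\<exists>u\<in>A. \<forall>a\<in>K. a \<ge> u"
    proof (cases "K = {}")
      case True
      then show ?thesis using assms by (auto simp: A_def)
    next
      \<comment> \<open>In a nonempty chain any two filters are comparable, so what is eventual in
        \<open>Inf K\<close> is already eventual in one member. Properness of the members thus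
        passes to \<open>Inf K\<close>.\<close>
      case False
      have "\<forall>\<^sub>F i in Inf K. P i \<Longrightarrow> \<exists>G\<in>K. \<forall>\<^sub>F i in G. P i" for P
        by (subst (asm) eventually_Inf_base) (use False ch in \<open>auto intro: inf_greatest\<close>)
      then have "Inf K \<noteq> bot"
        using sub unfolding trivial_limit_def A_def by blast
      moreover have "Inf K \<le> F"
        using False sub by (auto simp: A_def intro: Inf_lower2)
      ultimately show ?thesis by (auto simp: A_def intro: Inf_lower)
    qed
  qed
  then obtain U where U: "U \<le> F" "U \<noteq> bot" and max: "\<And>G. G \<le> U \<Longrightarrow> G \<noteq> bot \<Longrightarrow> G = U"
    unfolding A_def by (blast intro: order_trans)
  \<comment> \<open>Adding \<open>Q\<close> to \<open>U\<close> either makes the filter improper,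
    and then \<open>\<not> Q\<close> is eventual, or gives back \<open>U\<close> by
    minimality.\<close>
  have "(\<forall>\<^sub>F i in U. Q i) \<or> (\<forall>\<^sub>F i in U. \<not> Q i)" for Q
  proof (cases "inf U (principal {i. Q i}) = bot")
    case True
    then show ?thesis by (simp add: trivial_limit_def eventually_inf_principal)
  next
    case False
    then have "inf U (principal {i. Q i}) = U" by (intro max) auto
    then have "U \<le> principal {i. Q i}" by (metis inf.cobounded2)
    then show ?thesis by (simp add: le_principal)
  qed
  with U that show thesis by blast
qed

text \<open>The limit is the supremum of the eventual lower bounds of \<open>f\<close>. A number
  above it is no such bound, and the ultrafilter property turns this failure into \<open>f\<close>
  being eventually smaller. This is the existence of standard parts.\<close>

lemma ultrafilter_bounded_tendsto:
  fixes f :: "'i \<Rightarrow> real"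
  assumes U: "ultrafilter_on I U" and bd: "\<forall>\<^sub>F i in U. a \<le> f i \<and> f i \<le> b"
  obtains r where "(f \<longlongrightarrow> r) U"
proof -
  define R where "R = {r. \<forall>\<^sub>F i in U. r \<le> f i}"
  have ub: "r \<le> b" if "r \<in> R" for r
  proof -
    have "\<forall>\<^sub>F i in U. r \<le> b"
      using bd that unfolding R_def mem_Collect_eq by eventually_elim auto
    then show ?thesis using U by (simp add: ultrafilter_on_def)
  qed
  have bdd: "bdd_above R" using ub unfolding bdd_above_def by blast
  have ne: "R \<noteq> {}" using bd by (auto simp: R_def elim: eventually_mono)
  have "(f \<longlongrightarrow> Sup R) U"
  proof (rule order_tendstoI)
    fix y assume "y < Sup R"
    then obtain r where "r \<in> R" "y < r" using less_cSup_iff[OF ne bdd] by blast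
    then show "\<forall>\<^sub>F i in U. y < f i"
      by (auto simp: R_def elim: eventually_mono)
  next
    fix y assume "Sup R < y"
    then have "y \<notin> R" using cSup_upper[OF _ bdd] by (meson not_le)
    then have "\<forall>\<^sub>F i in U. \<not> y \<le> f i"
      using U by (auto simp: R_def ultrafilter_on_def)
    then show "\<forall>\<^sub>F i in U. f i < y" by (simp add: not_le)
  qed
  then show thesis using that by blast
qed

section \<open>Ultrapower operations on representatives\<close>

lemma mem_hclass [simp]: "g \<in> hclass U f \<longleftrightarrow> (\<forall>\<^sub>F i in U. f i = g i)"
  by (simp add: hclass_def ultra_rel_def)

lemma hclass_eqI:
  assumes "\<forall>\<^sub>F i in U. f i = g i" shows "hclass U f = hclass U g"
proof -
  have "(\<forall>\<^sub>F i in U. f i = h i) \<longleftrightarrow> (\<forall>\<^sub>F i in U. g i = h i)" for h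
    by (rule eventually_subst) (use assms in eventually_elim, simp)
  then show ?thesis by auto
qed

text \<open>The union in \<open>hdivide\<close> runs over all representatives; they all yield the
  same class, so it collapses to that class.\<close>

lemma hdivide_hclass [simp]:
  "hdivide U (hclass U f) (hclass U g) = hclass U (\<lambda>i. f i / g i)"
proof -
  have "hclass U (\<lambda>i. f' i / g' i) = hclass U (\<lambda>i. f i / g i)"
    if "f' \<in> hclass U f" "g' \<in> hclass U g" for f' g'
    by (rule hclass_eqI) (use that[unfolded mem_hclass] in eventually_elim, simp)
  moreover have "f \<in> hclass U f" "g \<in> hclass U g" by simp_all
  ultimately show ?thesis unfolding hdivide_def by blast
qed

lemma hminus_hclass [simp]:
  "hminus U (hclass U f) (hclass U g) = hclass U (\<lambda>i. f i - g i)"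
proof -
  have "hclass U (\<lambda>i. f' i - g' i) = hclass U (\<lambda>i. f i - g i)"
    if "f' \<in> hclass U f" "g' \<in> hclass U g" for f' g'
    by (rule hclass_eqI) (use that[unfolded mem_hclass] in eventually_elim, simp)
  moreover have "f \<in> hclass U f" "g \<in> hclass U g" by simp_all
  ultimately show ?thesis unfolding hminus_def by blast
qed

lemma habs_hclass [simp]: "habs U (hclass U f) = hclass U (\<lambda>i. \<bar>f i\<bar>)"
proof -
  have "hclass U (\<lambda>i. \<bar>f' i\<bar>) = hclass U (\<lambda>i. \<bar>f i\<bar>)" if "f' \<in> hclass U f" for f'
    by (rule hclass_eqI) (use that[unfolded mem_hclass] in eventually_elim, simp)
  moreover have "f \<in> hclass U f" by simp
  ultimately show ?thesis unfolding habs_def by blast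
qed

lemma hless_hclass [simp]: "hless U (hclass U f) (hclass U g) \<longleftrightarrow> (\<forall>\<^sub>F i in U. f i < g i)"
proof
  assume "hless U (hclass U f) (hclass U g)"
  then obtain f' g' where "\<forall>\<^sub>F i in U. f i = f' i" "\<forall>\<^sub>F i in U. g i = g' i" "\<forall>\<^sub>F i in U. f' i < g' i"
    by (auto simp: hless_def)
  then show "\<forall>\<^sub>F i in U. f i < g i" by eventually_elim simp
next
  assume "\<forall>\<^sub>F i in U. f i < g i"
  moreover have "f \<in> hclass U f" "g \<in> hclass U g" by simp_all
  ultimately show "hless U (hclass U f) (hclass U g)" unfolding hless_def by blast
qed

text \<open>This reduces standard parts to limits along \<open>U\<close>: from here on their
  existence and uniqueness are those of limits.\<close>

lemma infinitely_close_hreal_iff: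
  "infinitely_close U (hclass U f) (hreal U r) \<longleftrightarrow> (f \<longlongrightarrow> r) U"
  by (simp add: infinitely_close_def hreal_def tendsto_iff dist_real_def)

lemma st_hclass:
  assumes "U \<noteq> bot" "(f \<longlongrightarrow> r) U"
  shows "st U (hclass U f) = r"
  unfolding st_def infinitely_close_hreal_iff
  using assms tendsto_unique by blast

lemma st_nap_quotient:
  assumes "U \<noteq> bot" "((\<lambda>l. cond_prob w A l / cond_prob w B l) \<longlongrightarrow> r) U"
  shows "st U (hdivide U (nap_prob U w A) (nap_prob U w B)) = r"
  using st_hclass[OF assms] by (simp add: nap_prob_def)

section \<open>From NAP spaces to Popper functions\<close>

lemma cond_prob_nonneg:
  assumes "nap_space \<Omega> \<Lambda> U w" "l \<in> \<Lambda>"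
  shows "0 \<le> cond_prob w A l"
proof -
  have "0 < w x" if "x \<in> l" for x using assms that by (auto simp: nap_space_def)
  then show ?thesis
    unfolding cond_prob_def by (intro divide_nonneg_nonneg sum_nonneg) (auto intro: less_imp_le)
qed

lemma cond_prob_Un:
  assumes "nap_space \<Omega> \<Lambda> U w" "l \<in> \<Lambda>" "A \<inter> B = {}"
  shows "cond_prob w (A \<union> B) l = cond_prob w A l + cond_prob w B l"
proof -
  have fin: "finite l" using assms by (auto simp: nap_space_def)
  have "(A \<union> B) \<inter> l = (A \<inter> l) \<union> (B \<inter> l)" by blast
  then show ?thesis
    unfolding cond_prob_def add_divide_distrib[symmetric]
    by (simp, subst sum.union_disjoint) (use fin assms(3) in auto)
qed

lemma cond_prob_mono:
  assumes "nap_space \<Omega> \<Lambda> U w" "l \<in> \<Lambda>" "A \<subseteq> B"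
  shows "cond_prob w A l \<le> cond_prob w B l"
proof -
  have "cond_prob w (A \<union> (B - A)) l = cond_prob w A l + cond_prob w (B - A) l"
    by (rule cond_prob_Un[OF assms(1,2)]) auto
  then show ?thesis
    using cond_prob_nonneg[OF assms(1,2), of "B - A"] assms(3) by (simp add: Un_absorb1)
qed

text \<open>On each finite \<open>l\<close> that gives the conditions positive mass, additivity and
  the product rule are arithmetic. Regularity makes such \<open>l\<close> eventual, and both
  identities survive the limit. Indistinguishability does not pass through the limit directly, since
  the value one there tolerates infinitesimal defects; it is derived from the limit
  identities.\<close>

lemma nap_to_popper:
  fixes \<Omega> :: "'w set"
  assumes nap: "nap_space \<Omega> \<Lambda> U w" and reg: "nap_regular \<Omega> U w"
  shows "\<exists>C. popper_function (subset_language \<Omega>) C \<and>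
           (\<forall>A B. A \<subseteq> \<Omega> \<and> B \<subseteq> \<Omega> \<and> A \<noteq> {} \<longrightarrow>
              C B A = st U (hdivide U (nap_prob U w (B \<inter> A)) (nap_prob U w A)))"
proof -
  define m where "m = cond_prob w"
  \<comment> \<open>The default is forced: \<open>C {} {} = 1\<close>, and the product rule for
    \<open>B \<inter> {}\<close> given \<open>{}\<close> then yields
    \<open>C B {} = 1\<close>.\<close>
  define C where "C B A =
    (if A = {} then 1 else st U (hdivide U (nap_prob U w (B \<inter> A)) (nap_prob U w A)))" for B A
  have ult: "ultrafilter_on \<Lambda> U" and bot: "U \<noteq> bot" and mem: "\<forall>\<^sub>F l in U. l \<in> \<Lambda>"
    using nap by (auto simp: nap_space_def ultrafilter_on_def)
  have pos: "\<forall>\<^sub>F l in U. l \<in> \<Lambda> \<and> 0 < m A l" if "A \<subseteq> \<Omega>" "A \<noteq> {}" for A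
    using reg that mem by (auto simp: nap_regular_def hreal_def nap_prob_def m_def eventually_conj_iff)
  have lim: "((\<lambda>l. m (B \<inter> A) l / m A l) \<longlongrightarrow> C B A) U"
    and bounds: "0 \<le> C B A" "C B A \<le> 1"
    if A: "A \<subseteq> \<Omega>" "A \<noteq> {}" for A B
  proof -
    have bd: "\<forall>\<^sub>F l in U. 0 \<le> m (B \<inter> A) l / m A l \<and> m (B \<inter> A) l / m A l \<le> 1"
      using pos[OF A]
    proof eventually_elim
      case (elim l)
      then show ?case
        using cond_prob_mono[OF nap, of l "B \<inter> A" A] cond_prob_nonneg[OF nap, of l "B \<inter> A"]
        by (simp add: m_def)
    qed
    obtain r where r: "((\<lambda>l. m (B \<inter> A) l / m A l) \<longlongrightarrow> r) U"
      using ultrafilter_bounded_tendsto[OF ult bd] .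
    have "C B A = r"
      using st_nap_quotient[OF bot r[unfolded m_def]] A by (simp add: C_def)
    with r show lim: "((\<lambda>l. m (B \<inter> A) l / m A l) \<longlongrightarrow> C B A) U" by simp
    show "0 \<le> C B A" "C B A \<le> 1"
      using tendsto_lowerbound[OF lim _ bot] tendsto_upperbound[OF lim _ bot] bd
      by (auto simp: eventually_conj_iff)
  qed
  \<comment> \<open>Uniqueness of limits: an eventual identity between quotients becomes an identity
    for \<open>C\<close>.\<close>
  have limI: "C B A = r"
    if "A \<subseteq> \<Omega>" "A \<noteq> {}" "\<forall>\<^sub>F l in U. m (B \<inter> A) l / m A l = f l" "(f \<longlongrightarrow> r) U" for A B f r
    using tendsto_unique[OF bot lim[OF that(1,2)]] tendsto_cong[OF that(3)] that(4) by blast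
  have sup: "C B A = 1" if "A \<subseteq> \<Omega>" "A \<subseteq> B" for A B
  proof (cases "A = {}")
    case False
    have "\<forall>\<^sub>F l in U. m (B \<inter> A) l / m A l = 1"
      using pos[OF that(1) False] by eventually_elim (use that in \<open>simp add: Int_absorb1\<close>)
    then show ?thesis by (rule limI[OF that(1) False]) simp
  qed (simp add: C_def)
  have add: "C (B \<union> B') A = C B A + C B' A"
    if A: "A \<subseteq> \<Omega>" "A \<noteq> {}" and "B \<inter> B' = {}" for A B B'
  proof (rule limI[OF A])
    show "\<forall>\<^sub>F l in U. m ((B \<union> B') \<inter> A) l / m A l = m (B \<inter> A) l / m A l + m (B' \<inter> A) l / m A l"
      using mem
    proof eventually_elim
      case (elim l)
      then show ?case
        using cond_prob_Un[OF nap elim, of "B \<inter> A" "B' \<inter> A"] that(3)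
        by (simp add: m_def Int_Un_distrib2 add_divide_distrib disjoint_iff)
    qed
    show "((\<lambda>l. m (B \<inter> A) l / m A l + m (B' \<inter> A) l / m A l) \<longlongrightarrow> C B A + C B' A) U"
      by (intro tendsto_add lim A)
  qed
  have empty: "C {} A = 0" if A: "A \<subseteq> \<Omega>" "A \<noteq> {}" for A
    using add[OF A, of "{}" "{}"] by simp
  have disj: "C B A = 0" if A: "A \<subseteq> \<Omega>" "A \<noteq> {}" and "B \<inter> A = {}" for A B
    using empty[OF A] that by (simp add: C_def)
  have mult: "C (A \<inter> B) D = C A D * C B (A \<inter> D)" if D: "D \<subseteq> \<Omega>" for A B D
  proof -
    \<comment> \<open>The quotients can be cancelled only where \<open>A \<inter> D\<close> has
      positive mass. If \<open>D\<close> is empty both sides are \<open>1\<close>; if only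
      \<open>A \<inter> D\<close> is empty both are \<open>0\<close>.\<close>
    consider "D = {}" | "D \<noteq> {}" "A \<inter> D = {}" | "D \<noteq> {}" "A \<inter> D \<noteq> {}" by blast
    then show ?thesis
    proof cases
      case 1 then show ?thesis by (simp add: C_def)
    next
      case 2
      then show ?thesis using disj[OF D, of A] disj[OF D, of "A \<inter> B"] by auto
    next
      case 3
      have AD: "A \<inter> D \<subseteq> \<Omega>" using D by blast
      show ?thesis
      proof (rule limI[OF D 3(1)])
        show "\<forall>\<^sub>F l in U. m (A \<inter> B \<inter> D) l / m D l
            = (m (A \<inter> D) l / m D l) * (m (B \<inter> (A \<inter> D)) l / m (A \<inter> D) l)"
          using pos[OF AD 3(2)] by eventually_elim (simp add: Int_ac)
        show "((\<lambda>l. (m (A \<inter> D) l / m D l) * (m (B \<inter> (A \<inter> D)) l / m (A \<inter> D) l))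
            \<longlongrightarrow> C A D * C B (A \<inter> D)) U"
          by (intro tendsto_mult lim D AD 3)
      qed
    qed
  qed
  \<comment> \<open>The part of \<open>D\<close> outside \<open>B\<close> is null given
    \<open>A\<close>, and the product rule then moves the condition to \<open>A \<inter> B\<close>.
    The complement \<open>- B\<close> may leave \<Omega>; only its trace on \<open>A\<close>
    enters.\<close>
  have swap: "C D A = C D (A \<inter> B)"
    if A: "A \<subseteq> \<Omega>" "A \<noteq> {}" and "C B A = 1" for A B D
  proof -
    have "C (- B) A = 0"
      using add[OF A, of B "- B"] sup[of A UNIV] A that(3) by simp
    then have "C (D - B) A = 0"
      using mult[OF A(1), of "- B" D] by (simp add: Int_commute Diff_eq)
    moreover have "C D A = C (B \<inter> D) A + C (D - B) A"
    proof -
      have "B \<inter> D \<union> (D - B) = D" "(B \<inter> D) \<inter> (D - B) = {}" by blast+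
      then show ?thesis using add[OF A, of "B \<inter> D" "D - B"] by simp
    qed
    ultimately show ?thesis
      using mult[OF A(1), of B D] that(3) by (simp add: Int_commute)
  qed
  \<comment> \<open>An empty set has value \<open>0\<close> given a nonempty one, so
    \<open>A\<close> and \<open>B\<close> are empty together. Otherwise \<open>swap\<close> reduces
    both conditions to \<open>A \<inter> B\<close>.\<close>
  have indist: "C D A = C D B" if "A \<subseteq> \<Omega>" "B \<subseteq> \<Omega>" "C A B = 1" "C B A = 1" for A B D
  proof (cases "A = {} \<or> B = {}")
    case True
    then have "A = B" using that empty[of A] empty[of B] by fastforce
    then show ?thesis by simp
  next
    case False
    then show ?thesis using swap[of A B D] swap[of B A D] that by (simp add: Int_commute)
  qed
  have unit: "0 \<le> C B A \<and> C B A \<le> 1" if "A \<subseteq> \<Omega>" for A B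
    using bounds[OF that] by (cases "A = {}") (auto simp: C_def)
  have prob: "fin_add_prob (subset_language \<Omega>) (\<lambda>x. C x A)"
    if A: "A \<subseteq> \<Omega>" and "C (\<Omega> - A) A \<noteq> 1" for A
  proof -
    have ne: "A \<noteq> {}" using that by (auto simp: C_def)
    show ?thesis
      unfolding fin_add_prob_def
    proof (intro conjI ballI impI)
      fix B assume "tautology (subset_language \<Omega>) B"
      then show "C B A = 1" using A by (intro sup) (auto simp: tautology_def subset_language_def)
    next
      fix B B' assume "B \<in> sentences (subset_language \<Omega>)" "B' \<in> sentences (subset_language \<Omega>)"
        and "log_equiv (subset_language \<Omega>) B B'"
      then have "B = B'" by (auto simp: log_equiv_def subset_language_def)
      then show "C B A = C B' A" by simp
    next
      fix B B' assume "B \<in> sentences (subset_language \<Omega>)" "B' \<in> sentences (subset_language \<Omega>)"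
        and "contradiction (subset_language \<Omega>) (lconj (subset_language \<Omega>) B B')"
      then have "B \<inter> B' = {}" by (auto simp: contradiction_def subset_language_def)
      then show "C (ldisj (subset_language \<Omega>) B B') A = C B A + C B' A"
        using add[OF A ne] by (simp add: subset_language_def)
    qed (use unit[OF A] in simp)
  qed
  have "popper_function (subset_language \<Omega>) C"
    unfolding popper_function_def
  proof (intro conjI ballI impI)
    fix A B D
    assume AB: "A \<in> sentences (subset_language \<Omega>)" "B \<in> sentences (subset_language \<Omega>)"
      and "log_equiv (subset_language \<Omega>) A B"
    then have "A = B" by (auto simp: subset_language_def log_equiv_def)
    then show "C D A = C D B" by simp
  next
    fix A B D
    assume "A \<in> sentences (subset_language \<Omega>)" "B \<in> sentences (subset_language \<Omega>)"
      and "C A B = 1 \<and> C B A = 1"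
    then show "C D A = C D B" by (intro indist) (auto simp: subset_language_def)
  next
    fix A assume "A \<in> sentences (subset_language \<Omega>)" "C (lneg (subset_language \<Omega>) A) A \<noteq> 1"
    then show "fin_add_prob (subset_language \<Omega>) (\<lambda>x. C x A)"
      by (intro prob) (auto simp: subset_language_def)
  qed (use unit sup mult in \<open>simp_all add: subset_language_def\<close>)
  moreover have "\<forall>A B. A \<subseteq> \<Omega> \<and> B \<subseteq> \<Omega> \<and> A \<noteq> {} \<longrightarrow>
              C B A = st U (hdivide U (nap_prob U w (B \<inter> A)) (nap_prob U w A))"
    by (simp add: C_def)
  ultimately show ?thesis by blast
qed

section \<open>Finite approximation of a Popper function by counting\<close>

text \<open>Sentences are replaced by their sets of models, so logical equivalence is equality. The
  clause \<open>abnormal\<close> stands in for the two clauses on exchanging conditions; for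
  formulas it is \<open>C_abnormal\<close>.\<close>

locale popper_algebra =
  fixes \<A> :: "'v set set" and c :: "'v set \<Rightarrow> 'v set \<Rightarrow> real"
  assumes UNIV_in: "UNIV \<in> \<A>"
    and Compl_in: "A \<in> \<A> \<Longrightarrow> - A \<in> \<A>"
    and Int_in: "A \<in> \<A> \<Longrightarrow> B \<in> \<A> \<Longrightarrow> A \<inter> B \<in> \<A>"
    and nonneg: "A \<in> \<A> \<Longrightarrow> B \<in> \<A> \<Longrightarrow> 0 \<le> c A B"
    and self: "A \<in> \<A> \<Longrightarrow> c A A = 1"
    and additive: "\<lbrakk>A \<in> \<A>; B \<in> \<A>; D \<in> \<A>; c (- D) D \<noteq> 1; A \<inter> B = {}\<rbrakk>
      \<Longrightarrow> c (A \<union> B) D = c A D + c B D"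
    and multiplicative: "\<lbrakk>A \<in> \<A>; B \<in> \<A>; D \<in> \<A>\<rbrakk> \<Longrightarrow> c (A \<inter> B) D = c A D * c B (A \<inter> D)"
    and abnormal: "\<lbrakk>A \<in> \<A>; D \<in> \<A>; c (- D) D = 1\<rbrakk> \<Longrightarrow> c A D = 1"
begin

lemma Un_in: "A \<in> \<A> \<Longrightarrow> B \<in> \<A> \<Longrightarrow> A \<union> B \<in> \<A>"
  using Compl_in[OF Int_in[OF Compl_in Compl_in], of A B] by simp

lemma empty_in: "{} \<in> \<A>"
  using Compl_in[OF UNIV_in] by simp

lemma Union_in: "finite X \<Longrightarrow> X \<subseteq> \<A> \<Longrightarrow> \<Union>X \<in> \<A>"
  by (induction X rule: finite_induct) (auto intro: Un_in empty_in)

lemma Inter_in: "finite X \<Longrightarrow> X \<subseteq> \<A> \<Longrightarrow> \<Inter>X \<in> \<A>"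
  by (induction X rule: finite_induct) (auto intro: Int_in UNIV_in)

text \<open>Given an abnormal \<open>D\<close> even \<open>A \<inter> - A\<close> has value
  \<open>1\<close>, and the product rule splits this value into \<open>c A D = 1\<close> and
  \<open>c (- A) A\<close>.\<close>

lemma abnormal_subset:
  assumes "A \<in> \<A>" "D \<in> \<A>" "A \<subseteq> D" "c (- D) D = 1"
  shows "c (- A) A = 1"
proof -
  have "c (A \<inter> - A) D = c A D * c (- A) (A \<inter> D)"
    using assms by (intro multiplicative Compl_in)
  moreover have "c (A \<inter> - A) D = 1" "c A D = 1"
    using assms by (auto intro!: abnormal empty_in)
  ultimately show ?thesis using assms(3) by (simp add: Int_absorb2)
qed

lemma additive_Union:
  assumes "finite X" "X \<subseteq> \<A>" "disjoint X" "D \<in> \<A>" "c (- D) D \<noteq> 1"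
  shows "c (\<Union>X) D = (\<Sum>A\<in>X. c A D)"
  using assms(1-3)
proof (induction X rule: finite_induct)
  case empty
  show ?case using additive[of "{}" "{}" D] empty_in assms by simp
next
  case (insert A X)
  have "A \<inter> \<Union>X = {}"
    using insert.prems(2) insert.hyps(2) by (force simp: disjoint_def pairwise_def disjnt_def)
  then have "c (A \<union> \<Union>X) D = c A D + c (\<Union>X) D"
    using insert assms by (intro additive Union_in) auto
  then show ?case using insert by (simp add: pairwise_insert)
qed

text \<open>
  Induction over the finite union \<open>\<Union>Y\<close> of cells. The cells that are null given \<open>\<Union>Y\<close> receive counts
  by the induction hypothesis; adding about \<open>M * c A (\<Union>Y)\<close> to the count of each cell \<open>A\<close> leaves those
  unchanged and, for large \<open>M\<close>, makes everything already counted negligible against the other cells.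
\<close>

lemma counting_approximation:
  fixes f :: "'v set \<Rightarrow> nat" and \<epsilon> :: real
  assumes "finite Y" "Y \<subseteq> \<A>" "disjoint Y" "0 < \<epsilon>"
  shows "\<exists>N :: 'v set \<Rightarrow> nat. (\<forall>A. f A \<le> N A) \<and>
    (\<forall>Z \<subseteq> Y. \<forall>X \<subseteq> Z. c (- \<Union>Z) (\<Union>Z) \<noteq> 1 \<longrightarrow>
      \<bar>(\<Sum>A\<in>X. real (N A)) / (\<Sum>A\<in>Z. real (N A)) - c (\<Union>X) (\<Union>Z)\<bar> < \<epsilon>)"
  using assms(1-3)
proof (induction Y rule: finite_psubset_induct)
  case (psubset Y)
  have UY: "\<Union>Y \<in> \<A>" using psubset by (intro Union_in)
  have sub: "\<Union>Z \<in> \<A>" "finite Z" "disjoint Z" "Z \<subseteq> \<A>" if "Z \<subseteq> Y" for Z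
    using that psubset by (auto intro!: Union_in intro: finite_subset pairwise_subset)
  show ?case
  proof (cases "c (- \<Union>Y) (\<Union>Y) = 1")
    \<comment> \<open>Every union of a subfamily is then abnormal, so nothing has to be approximated
      and \<open>f\<close> itself serves.\<close>
    case True
    have "c (- \<Union>Z) (\<Union>Z) = 1" if "Z \<subseteq> Y" for Z
      using abnormal_subset[OF sub(1)[OF that] UY _ True] that by auto
    then show ?thesis by (intro exI[of _ f]) auto
  next
    case False
    define p where "p A = c A (\<Union>Y)" for A
    have p_Union: "p (\<Union>Z) = (\<Sum>A\<in>Z. p A)" if "Z \<subseteq> Y" for Z
      unfolding p_def using that sub[OF that] UY False by (intro additive_Union)
    have p_nonneg: "0 \<le> p A" if "A \<in> Y" for A
      unfolding p_def using that psubset.prems UY by (intro nonneg) auto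
    define Y0 where "Y0 = {A \<in> Y. p A = 0}"
    \<comment> \<open>If all cells were null, additivity would give \<open>\<Union>Y\<close> the
      value \<open>0\<close> given itself. So \<open>Y0\<close> is a proper subfamily and the
      induction hypothesis applies to it.\<close>
    have "p (\<Union>Y) = 1" unfolding p_def using self UY by simp
    moreover have "p (\<Union>Y) = 0" if "Y0 = Y"
      unfolding p_Union[OF subset_refl] by (rule sum.neutral) (use that in \<open>auto simp: Y0_def\<close>)
    ultimately have "Y0 \<subset> Y" by (auto simp: Y0_def)
    then obtain N0 where N0: "\<And>A. f A \<le> N0 A"
      and approx0: "\<And>Z X. Z \<subseteq> Y0 \<Longrightarrow> X \<subseteq> Z \<Longrightarrow> c (- \<Union>Z) (\<Union>Z) \<noteq> 1 \<Longrightarrow>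
        \<bar>(\<Sum>A\<in>X. real (N0 A)) / (\<Sum>A\<in>Z. real (N0 A)) - c (\<Union>X) (\<Union>Z)\<bar> < \<epsilon>"
      using psubset.IH[of Y0] sub[of Y0] by (metis psubset_imp_subset)
    \<comment> \<open>A null cell receives the extra count \<open>0\<close> and keeps
      \<open>N0\<close>. Divided by \<open>M\<close>, the count of each cell tends to
      \<open>p A\<close>.\<close>
    define N where "N M A = N0 A + nat \<lceil>real M * p A\<rceil>" for M :: nat and A
    have N_lim: "(\<lambda>M. real (N M A) / real M) \<longlonglongrightarrow> p A" if "A \<in> Y" for A
    proof (rule tendsto_sandwich)
      have ceil: "real M * p A \<le> real (nat \<lceil>real M * p A\<rceil>)"
          "real (nat \<lceil>real M * p A\<rceil>) \<le> real M * p A + 1" for M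
        using p_nonneg[OF that] by auto
      show "\<forall>\<^sub>F M in sequentially. p A \<le> real (N M A) / real M"
        using eventually_gt_at_top[of 0]
      proof eventually_elim
        case (elim M)
        then show ?case using ceil(1)[of M] by (simp add: N_def field_simps)
      qed
      show "\<forall>\<^sub>F M in sequentially. real (N M A) / real M \<le> p A + (real (N0 A) + 1) / real M"
        using eventually_gt_at_top[of 0]
      proof eventually_elim
        case (elim M)
        then have "real (N M A) / real M \<le> (real (N0 A) + 1 + real M * p A) / real M"
          using ceil(2)[of M] by (intro divide_right_mono) (auto simp: N_def)
        then show ?case using elim by (simp add: add_divide_distrib)
      qed
      have "(\<lambda>M. p A + (real (N0 A) + 1) / real M) \<longlonglongrightarrow> p A + 0"
        by (intro tendsto_add tendsto_const lim_const_over_n)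
      then show "(\<lambda>M. p A + (real (N0 A) + 1) / real M) \<longlonglongrightarrow> p A" by simp
    qed simp
    \<comment> \<open>A finite \<open>Y\<close> has finitely many subfamilies, so a single
      \<open>M\<close> serves all of them.\<close>
    have "\<forall>\<^sub>F M in sequentially. \<forall>Z\<in>Pow Y. \<forall>X\<in>Pow Z. p (\<Union>Z) \<noteq> 0 \<longrightarrow>
      \<bar>(\<Sum>A\<in>X. real (N M A)) / (\<Sum>A\<in>Z. real (N M A)) - c (\<Union>X) (\<Union>Z)\<bar> < \<epsilon>"
    proof (intro eventually_ball_finite ballI, goal_cases)
      case (3 Z X)
      then have Z: "Z \<subseteq> Y" and X: "X \<subseteq> Z" "X \<subseteq> Y" by auto
      show ?case
      proof (cases "p (\<Union>Z) = 0")
        case pos: False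
        \<comment> \<open>The product rule makes the value given \<open>\<Union>Z\<close> a quotient
          of values given \<open>\<Union>Y\<close>, which is the limit of the count ratios.\<close>
        have "p (\<Union>Z \<inter> \<Union>X) = p (\<Union>Z) * c (\<Union>X) (\<Union>Z \<inter> \<Union>Y)"
          unfolding p_def using sub(1) Z X UY by (intro multiplicative)
        moreover have "\<Union>Z \<inter> \<Union>X = \<Union>X" "\<Union>Z \<inter> \<Union>Y = \<Union>Z" using X Z by blast+
        ultimately have eq: "c (\<Union>X) (\<Union>Z) = (\<Sum>A\<in>X. p A) / (\<Sum>A\<in>Z. p A)"
          using pos p_Union[OF Z] p_Union[OF X(2)] by (simp add: field_simps)
        have "(\<lambda>M. (\<Sum>A\<in>X. real (N M A) / real M) / (\<Sum>A\<in>Z. real (N M A) / real M))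
            \<longlonglongrightarrow> c (\<Union>X) (\<Union>Z)"
          unfolding eq using X Z pos p_Union[OF Z]
          by (intro tendsto_divide tendsto_sum N_lim) auto
        then have "\<forall>\<^sub>F M in sequentially.
            \<bar>(\<Sum>A\<in>X. real (N M A) / real M) / (\<Sum>A\<in>Z. real (N M A) / real M) - c (\<Union>X) (\<Union>Z)\<bar> < \<epsilon>"
          using assms(4) by (simp add: tendsto_iff dist_real_def)
        then show ?thesis
          using eventually_gt_at_top[of 0]
          by eventually_elim (simp add: sum_divide_distrib[symmetric])
      qed simp
    qed (use psubset.hyps finite_subset in auto)
    then obtain M where M: "\<And>Z X. Z \<subseteq> Y \<Longrightarrow> X \<subseteq> Z \<Longrightarrow> p (\<Union>Z) \<noteq> 0 \<Longrightarrow>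
      \<bar>(\<Sum>A\<in>X. real (N M A)) / (\<Sum>A\<in>Z. real (N M A)) - c (\<Union>X) (\<Union>Z)\<bar> < \<epsilon>"
      unfolding eventually_sequentially by blast
    show ?thesis
    proof (intro exI[of _ "N M"] conjI allI impI)
      show "f A \<le> N M A" for A using N0[of A] by (simp add: N_def)
    next
      fix Z X assume Z: "Z \<subseteq> Y" and X: "X \<subseteq> Z" and normal: "c (- \<Union>Z) (\<Union>Z) \<noteq> 1"
      show "\<bar>(\<Sum>A\<in>X. real (N M A)) / (\<Sum>A\<in>Z. real (N M A)) - c (\<Union>X) (\<Union>Z)\<bar> < \<epsilon>"
      proof (cases "p (\<Union>Z) = 0")
        \<comment> \<open>A null union consists of null cells, and these have the counts from the
          induction hypothesis.\<close>
        case True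
        then have "\<forall>A\<in>Z. p A = 0"
          using p_Union[OF Z] sum_nonneg_eq_0_iff[of Z p] sub(2)[OF Z] p_nonneg Z by auto
        then have "Z \<subseteq> Y0" and "\<And>A. A \<in> Z \<Longrightarrow> N M A = N0 A"
          using Z by (auto simp: Y0_def N_def)
        then show ?thesis
          using approx0[OF _ X normal] X by (simp add: subset_iff cong: sum.cong)
      qed (use M Z X in auto)
    qed
  qed
qed

text \<open>The cells are the atoms of the Boolean algebra generated by the given sets: two points
  share a cell iff they lie in the same of these sets.\<close>

lemma finite_partition:
  assumes "finite \<B>" "\<B> \<subseteq> \<A>"
  obtains Y where "finite Y" "Y \<subseteq> \<A>" "disjoint Y" "{} \<notin> Y" "\<Union>Y = UNIV"
    "\<And>B v. B \<in> \<B> \<Longrightarrow> v \<in> B \<Longrightarrow> \<exists>A\<in>Y. v \<in> A \<and> A \<subseteq> B"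
proof -
  define g where "g v B = (if v \<in> B then B else - B)" for v :: 'v and B
  define cell where "cell v = \<Inter>(g v ` \<B>)" for v
  have mem: "u \<in> cell v \<longleftrightarrow> (\<forall>B\<in>\<B>. u \<in> B \<longleftrightarrow> v \<in> B)" for u v
    by (auto simp: cell_def g_def)
  have eq: "cell u = cell v" if "u \<in> cell v" for u v
    using that by (intro set_eqI) (simp add: mem)
  have self: "v \<in> cell v" for v by (simp add: mem)
  show thesis
  proof (rule that[of "range cell"])
    \<comment> \<open>Each cell is the intersection of some of the finitely many given sets and
      their complements.\<close>
    have "range cell \<subseteq> Inter ` Pow (\<B> \<union> uminus ` \<B>)"
      by (auto simp: cell_def g_def intro!: imageI)
    then show "finite (range cell)"
      by (rule finite_subset) (use assms in auto)
    have "cell v \<in> \<A>" for v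
      unfolding cell_def using assms by (intro Inter_in) (auto simp: g_def intro: Compl_in)
    then show "range cell \<subseteq> \<A>" by blast
    show "disjoint (range cell)"
      unfolding disjoint_def using eq by (metis Int_iff all_not_in_conv rangeE)
    show "{} \<notin> range cell" "\<Union>(range cell) = UNIV" using self by blast+
    show "\<exists>A\<in>range cell. v \<in> A \<and> A \<subseteq> B" if "B \<in> \<B>" "v \<in> B" for B v
    proof (intro bexI[of _ "cell v"] conjI)
      show "cell v \<subseteq> B" using that by (auto simp: mem)
    qed (auto simp: self)
  qed
qed

text \<open>The counts are realized by points. Over a cell \<open>A\<close> the part of
  \<open>F\<close> is enlarged to exactly \<open>N A\<close> points, which is possible because the
  lower bound passed to \<open>counting_approximation\<close> is the number of points of
  \<open>F\<close> over \<open>A\<close>.\<close>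

lemma finite_set_approximation:
  fixes F :: "('v \<times> nat) set" and \<epsilon> :: real
  assumes "finite \<B>" "\<B> \<subseteq> \<A>" "finite F" "0 < \<epsilon>"
  shows "\<exists>l. finite l \<and> F \<subseteq> l \<and> (\<forall>A\<in>\<B>. \<forall>B\<in>\<B>. c (- B) B \<noteq> 1 \<longrightarrow>
    \<bar>real (card ((A \<inter> B) \<times> UNIV \<inter> l)) / real (card (B \<times> UNIV \<inter> l)) - c (A \<inter> B) B\<bar> < \<epsilon>)"
proof -
  obtain Y where Y: "finite Y" "Y \<subseteq> \<A>" "disjoint Y" "{} \<notin> Y" "\<Union>Y = UNIV"
    and cells: "\<And>B v. B \<in> \<B> \<Longrightarrow> v \<in> B \<Longrightarrow> \<exists>A\<in>Y. v \<in> A \<and> A \<subseteq> B"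
    using finite_partition[OF assms(1,2)] by metis
  from counting_approximation[OF Y(1-3) assms(4), of "\<lambda>A. card (F \<inter> A \<times> UNIV)"]
  obtain N where "(\<forall>A. card (F \<inter> A \<times> UNIV) \<le> N A) \<and>
    (\<forall>Z \<subseteq> Y. \<forall>X \<subseteq> Z. c (- \<Union>Z) (\<Union>Z) \<noteq> 1 \<longrightarrow>
      \<bar>(\<Sum>A\<in>X. real (N A)) / (\<Sum>A\<in>Z. real (N A)) - c (\<Union>X) (\<Union>Z)\<bar> < \<epsilon>)" ..
  then have N: "\<And>A. card (F \<inter> A \<times> UNIV) \<le> N A"
    and approx: "\<And>Z X. Z \<subseteq> Y \<Longrightarrow> X \<subseteq> Z \<Longrightarrow> c (- \<Union>Z) (\<Union>Z) \<noteq> 1 \<Longrightarrow>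
      \<bar>(\<Sum>A\<in>X. real (N A)) / (\<Sum>A\<in>Z. real (N A)) - c (\<Union>X) (\<Union>Z)\<bar> < \<epsilon>"
    by simp_all
  have "\<exists>T. F \<inter> A \<times> UNIV \<subseteq> T \<and> T \<subseteq> A \<times> UNIV \<and> finite T \<and> card T = N A" if "A \<in> Y" for A
  proof -
    \<comment> \<open>Cells are nonempty, so the copies indexed by the natural numbers leave room
      for any count.\<close>
    have "infinite (A \<times> (UNIV :: nat set))"
      using Y(4) that by (auto simp: finite_cartesian_product_iff)
    then have "infinite (A \<times> UNIV - F)" using assms(3) by simp
    then obtain T where T: "finite T" "card T = N A - card (F \<inter> A \<times> UNIV)" "T \<subseteq> A \<times> UNIV - F"
      using infinite_arbitrarily_large by metis
    have "card (F \<inter> A \<times> UNIV \<union> T) = card (F \<inter> A \<times> UNIV) + card T"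
      using T assms(3) by (intro card_Un_disjoint) auto
    then show ?thesis
      using T N[of A] assms(3) by (intro exI[of _ "F \<inter> A \<times> UNIV \<union> T"]) auto
  qed
  then obtain T where T: "\<And>A. A \<in> Y \<Longrightarrow> F \<inter> A \<times> UNIV \<subseteq> T A"
      "\<And>A. A \<in> Y \<Longrightarrow> T A \<subseteq> A \<times> UNIV" "\<And>A. A \<in> Y \<Longrightarrow> finite (T A)" "\<And>A. A \<in> Y \<Longrightarrow> card (T A) = N A"
    by metis
  define l where "l = (\<Union>A\<in>Y. T A)"
  have cell_eq: "A = A'" if "A \<in> Y" "A' \<in> Y" "v \<in> A" "v \<in> A'" for A A' v
    using Y(3) that by (auto simp: disjoint_def)
  \<comment> \<open>By disjointness of the cells, the points of \<open>l\<close> over a union of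
    cells are those chosen for exactly these cells.\<close>
  have card: "real (card (\<Union>X \<times> UNIV \<inter> l)) = (\<Sum>A\<in>X. real (N A))" if X: "X \<subseteq> Y" for X
  proof -
    have "\<Union>X \<times> UNIV \<inter> l = (\<Union>A\<in>X. T A)"
    proof (intro equalityI subsetI)
      fix z assume "z \<in> \<Union>X \<times> UNIV \<inter> l"
      then obtain A A' where A: "A \<in> X" "fst z \<in> A" and A': "A' \<in> Y" "z \<in> T A'"
        by (auto simp: l_def)
      then have "fst z \<in> A'" using T(2)[of A'] by auto
      then have "A = A'" using cell_eq[of A A'] A A' X by blast
      then show "z \<in> (\<Union>A\<in>X. T A)" using A A' by blast
    next
      fix z assume "z \<in> (\<Union>A\<in>X. T A)"
      then obtain A where A: "A \<in> X" "z \<in> T A" by blast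
      then have "z \<in> A \<times> UNIV" using T(2)[of A] X by blast
      then show "z \<in> \<Union>X \<times> UNIV \<inter> l" using A X by (auto simp: l_def)
    qed
    moreover have "card (\<Union>A\<in>X. T A) = (\<Sum>A\<in>X. card (T A))"
    proof (rule card_UN_disjoint)
      show "\<forall>i\<in>X. \<forall>j\<in>X. i \<noteq> j \<longrightarrow> T i \<inter> T j = {}"
      proof (intro ballI impI)
        fix i j assume ij: "i \<in> X" "j \<in> X" "i \<noteq> j"
        then have "i \<inter> j = {}" using Y(3) X by (auto simp: disjoint_def)
        moreover have "T i \<subseteq> i \<times> UNIV" "T j \<subseteq> j \<times> UNIV" using T(2) ij X by blast+
        ultimately show "T i \<inter> T j = {}" by blast
      qed
    qed (use X Y(1) T(3) finite_subset in auto)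
    moreover have "\<dots> = (\<Sum>A\<in>X. N A)"
      using X T(4) by (intro sum.cong) auto
    ultimately show ?thesis by simp
  qed
  show ?thesis
  proof (intro exI[of _ l] conjI ballI impI)
    show "finite l" using Y(1) T(3) by (simp add: l_def)
    show "F \<subseteq> l"
    proof
      fix z assume "z \<in> F"
      moreover obtain A where "A \<in> Y" "fst z \<in> A" using Y(5) by blast
      ultimately show "z \<in> l" using T(1)[of A] by (cases z) (auto simp: l_def)
    qed
  next
    fix A B assume A: "A \<in> \<B>" and B: "B \<in> \<B>" and normal: "c (- B) B \<noteq> 1"
    define Z where "Z = {D\<in>Y. D \<subseteq> B}"
    define X where "X = {D\<in>Y. D \<subseteq> A \<inter> B}"
    have UZ: "\<Union>Z = B" using cells[OF B] by (auto simp: Z_def)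
    \<comment> \<open>The intersection need not belong to the given family. A cell inside
      \<open>A\<close> and a cell inside \<open>B\<close> around the same point coincide, so it is
      nevertheless a union of cells.\<close>
    have "A \<inter> B \<subseteq> \<Union>X"
    proof
      fix v assume v: "v \<in> A \<inter> B"
      then obtain D E where "v \<in> D" "D \<in> Y" "D \<subseteq> A" "v \<in> E" "E \<in> Y" "E \<subseteq> B"
        using cells[OF A, of v] cells[OF B, of v] by blast
      then show "v \<in> \<Union>X" using cell_eq[of D E v] by (auto simp: X_def)
    qed
    then have UX: "\<Union>X = A \<inter> B" by (auto simp: X_def)
    have sub: "X \<subseteq> Z" "Z \<subseteq> Y" "X \<subseteq> Y" by (auto simp: X_def Z_def)
    show "\<bar>real (card ((A \<inter> B) \<times> UNIV \<inter> l)) / real (card (B \<times> UNIV \<inter> l)) - c (A \<inter> B) B\<bar> < \<epsilon>"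
      using approx[OF sub(2,1)] card[OF sub(3)] card[OF sub(2)] normal unfolding UZ UX by simp
  qed
qed

end

section \<open>From Popper functions to NAP spaces\<close>

locale form_popper =
  fixes S :: "'p form set" and C :: "'p form \<Rightarrow> 'p form \<Rightarrow> real"
  assumes closed: "closed_forms S" and popper: "popper_function (form_language S) C"
begin

section \<open>Formulas and their sets of satisfying valuations\<close>

definition ext :: "'p form \<Rightarrow> ('p \<Rightarrow> bool) set" where "ext a = {v. eval v a}"

lemma ext_simps [simp]:
  "ext (Neg a) = - ext a" "ext (Conj a b) = ext a \<inter> ext b" "ext (Disj a b) = ext a \<union> ext b"
  by (auto simp: ext_def)

lemma Neg_in: "a \<in> S \<Longrightarrow> Neg a \<in> S"
  and Conj_in: "a \<in> S \<Longrightarrow> b \<in> S \<Longrightarrow> Conj a b \<in> S"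
  and Disj_in: "a \<in> S \<Longrightarrow> b \<in> S \<Longrightarrow> Disj a b \<in> S"
  using closed by (auto simp: closed_forms_def)

lemma log_equiv_iff: "log_equiv (form_language S) a b \<longleftrightarrow> ext a = ext b"
  by (auto simp: log_equiv_def form_language_def ext_def)

lemma form_language_simps:
  "sentences (form_language S) = S" "lneg (form_language S) = Neg"
  "lconj (form_language S) = Conj" "ldisj (form_language S) = Disj"
  by (simp_all add: form_language_def)

lemmas C_axioms = popper[unfolded popper_function_def form_language_simps log_equiv_iff]

lemmas C_bounds = C_axioms[THEN conjunct1, rule_format]
  and C_self = C_axioms[THEN conjunct2, THEN conjunct1, rule_format]
  and C_prob = C_axioms[THEN conjunct2, THEN conjunct2, THEN conjunct1, rule_format]
  and C_mult = C_axioms[THEN conjunct2, THEN conjunct2, THEN conjunct2, THEN conjunct1, rule_format]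
  and C_indist = C_axioms[THEN conjunct2, THEN conjunct2, THEN conjunct2, THEN conjunct2,
    THEN conjunct1, rule_format]
  and C_cong_right = C_axioms[THEN conjunct2, THEN conjunct2, THEN conjunct2, THEN conjunct2,
    THEN conjunct2, rule_format]

text \<open>
  Given a contradiction \<open>x \<and> \<not>x\<close> the product rule makes both factors of \<open>C (x \<and> \<not>x) (x \<and> \<not>x) = 1\<close>
  equal to \<open>1\<close>, and an abnormal sentence is indistinguishable from a contradiction.
\<close>

lemma C_abnormal:
  assumes a: "a \<in> S" and x: "x \<in> S" and ab: "C (Neg a) a = 1"
  shows "C x a = 1"
proof -
  define d where "d = Conj a (Neg a)"
  have d: "d \<in> S" using a by (simp add: d_def Neg_in Conj_in)
  have contra: "C y d = 1" if y: "y \<in> S" for y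
  proof -
    define e where "e = Conj y (Neg y)"
    have e: "e \<in> S" using y by (simp add: e_def Neg_in Conj_in)
    have "C y e * C (Neg y) (Conj y e) = 1"
      using C_mult[OF y Neg_in[OF y] e] C_self[OF e] by (simp add: e_def)
    moreover have "C y e * C (Neg y) (Conj y e) \<le> C y e"
      using C_bounds[OF y e] C_bounds[OF Neg_in[OF y] Conj_in[OF y e]]
      by (intro mult_left_le) auto
    ultimately have "C y e = 1" using C_bounds[OF y e] by simp
    moreover have "C y d = C y e"
      by (rule C_cong_right[OF d e _ y]) (auto simp: d_def e_def)
    ultimately show ?thesis by simp
  qed
  have "C d a = C (Neg a) (Conj a a)"
    using C_mult[OF a Neg_in[OF a] a] C_self[OF a] by (simp add: d_def)
  also have "\<dots> = C (Neg a) a"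
    by (rule C_cong_right) (use a in \<open>auto intro: Neg_in Conj_in\<close>)
  finally have "C d a = 1" using ab by simp
  then show ?thesis using C_indist[OF a d _ x] contra[OF a] contra[OF x] by simp
qed

text \<open>On the left, a normal condition gives a probability, which respects equivalence, and an
  abnormal one gives the constant \<open>1\<close>. On the right it is an axiom.\<close>

lemma C_cong:
  assumes "a \<in> S" "a' \<in> S" "b \<in> S" "b' \<in> S" "ext a = ext a'" "ext b = ext b'"
  shows "C a b = C a' b'"
proof -
  have "C a b = C a' b"
  proof (cases "C (Neg b) b = 1")
    case True then show ?thesis using C_abnormal assms by simp
  next
    case False
    have "\<forall>x\<in>S. \<forall>y\<in>S. ext x = ext y \<longrightarrow> C x b = C y b"
      using C_prob[OF assms(3) False]
      unfolding fin_add_prob_def log_equiv_iff form_language_simps by (elim conjE)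
    then show ?thesis using assms by metis
  qed
  also have "\<dots> = C a' b'" by (rule C_cong_right[OF assms(3,4,6,2)])
  finally show ?thesis .
qed

text \<open>The product rule with \<open>C b b = 1\<close>, after exchanging the conjuncts. It lets
  the numerators of the approximating ratios be counted inside the condition.\<close>

lemma C_Conj_right:
  assumes "a \<in> S" "b \<in> S" shows "C (Conj a b) b = C a b"
proof -
  have "C (Conj a b) b = C (Conj b a) b"
    by (rule C_cong) (use assms in \<open>auto intro: Conj_in\<close>)
  also have "\<dots> = C a (Conj b b)" using C_mult[OF assms(2,1,2)] C_self[OF assms(2)] by simp
  also have "\<dots> = C a b" by (rule C_cong) (use assms in \<open>auto intro: Conj_in\<close>)
  finally show ?thesis .
qed

lemma C_additive:
  assumes "a \<in> S" "b \<in> S" "d \<in> S" "C (Neg d) d \<noteq> 1" "ext a \<inter> ext b = {}"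
  shows "C (Disj a b) d = C a d + C b d"
proof -
  have "contradiction (form_language S) (Conj a b)"
    using assms(5) by (auto simp: contradiction_def form_language_def ext_def)
  then show ?thesis
    using C_prob[OF assms(3,4)] assms(1,2) by (simp add: fin_add_prob_def form_language_def)
qed

lemma normal_satisfiable:
  assumes "b \<in> S" "C (Neg b) b \<noteq> 1" shows "ext b \<noteq> {}"
proof
  assume "ext b = {}"
  then have "tautology (form_language S) (Neg b)"
    by (auto simp: tautology_def form_language_def ext_def)
  then have "C (Neg b) b = 1"
    using C_prob[OF assms] Neg_in[OF assms(1)] by (simp add: fin_add_prob_def form_language_def)
  with assms show False by simp
qed

section \<open>Transfer to the algebra of definable sets of valuations\<close>

definition set_C :: "('p \<Rightarrow> bool) set \<Rightarrow> ('p \<Rightarrow> bool) set \<Rightarrow> real" where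
  "set_C A B = C (inv_into S ext A) (inv_into S ext B)"

text \<open>By \<open>C_cong\<close> the sentences picked by \<open>inv_into\<close> may be replaced
  by any others with the same models.\<close>

lemma set_C_ext:
  assumes "a \<in> S" "b \<in> S" shows "set_C (ext a) (ext b) = C a b"
proof -
  have "inv_into S ext (ext x) \<in> S" "ext (inv_into S ext (ext x)) = ext x" if "x \<in> S" for x
    using that by (simp_all add: inv_into_into f_inv_into_f)
  then show ?thesis unfolding set_C_def using assms by (intro C_cong) simp_all
qed

lemma set_C_Neg: "a \<in> S \<Longrightarrow> set_C (- ext a) (ext a) = C (Neg a) a"
  and set_C_Conj: "a \<in> S \<Longrightarrow> b \<in> S \<Longrightarrow> d \<in> S \<Longrightarrow> set_C (ext a \<inter> ext b) (ext d) = C (Conj a b) d"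
  and set_C_Disj: "a \<in> S \<Longrightarrow> b \<in> S \<Longrightarrow> d \<in> S \<Longrightarrow> set_C (ext a \<union> ext b) (ext d) = C (Disj a b) d"
  and set_C_Conj_right:
    "a \<in> S \<Longrightarrow> b \<in> S \<Longrightarrow> d \<in> S \<Longrightarrow> set_C (ext b) (ext a \<inter> ext d) = C b (Conj a d)"
  by (metis ext_simps set_C_ext Neg_in Conj_in Disj_in)+

lemmas set_C_simps = set_C_ext set_C_Neg set_C_Conj set_C_Disj set_C_Conj_right

lemma popper_algebra_ext:
  assumes "S \<noteq> {}"
  shows "popper_algebra (ext ` S) set_C"
proof
  \<comment> \<open>Excluded middle for some sentence supplies the unit of the algebra; hence the
    assumption that \<open>S\<close> is nonempty.\<close>
  obtain a where "a \<in> S" using assms by blast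
  then have "Disj a (Neg a) \<in> S" by (intro Disj_in Neg_in)
  then show "UNIV \<in> ext ` S" by (rule rev_image_eqI) simp
next
  fix A assume "A \<in> ext ` S"
  then obtain a where "a \<in> S" "A = ext a" by blast
  then show "- A \<in> ext ` S" "set_C A A = 1"
    by (auto simp: set_C_simps C_self intro!: rev_image_eqI[OF Neg_in])
next
  fix A B assume "A \<in> ext ` S" "B \<in> ext ` S"
  then obtain a b where "a \<in> S" "b \<in> S" "A = ext a" "B = ext b" by blast
  then show "A \<inter> B \<in> ext ` S" "0 \<le> set_C A B"
    using C_bounds by (auto simp: set_C_simps intro!: rev_image_eqI[OF Conj_in[of a b]])
next
  fix A D assume "A \<in> ext ` S" "D \<in> ext ` S"
  then obtain a d where "a \<in> S" "d \<in> S" "A = ext a" "D = ext d" by blast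
  moreover assume "set_C (- D) D = 1"
  ultimately show "set_C A D = 1" using C_abnormal[of d a] by (simp add: set_C_simps)
next
  fix A B D assume "A \<in> ext ` S" "B \<in> ext ` S" "D \<in> ext ` S"
  then obtain a b d where abd: "a \<in> S" "b \<in> S" "d \<in> S" "A = ext a" "B = ext b" "D = ext d" by blast
  then show "set_C (A \<inter> B) D = set_C A D * set_C B (A \<inter> D)" using C_mult[of a b d] by (simp add: set_C_simps)
  assume "set_C (- D) D \<noteq> 1" "A \<inter> B = {}"
  then show "set_C (A \<union> B) D = set_C A D + set_C B D" using C_additive[of a b d] abd by (simp add: set_C_simps)
qed

lemma finite_approximation:
  fixes F :: "(('p \<Rightarrow> bool) \<times> nat) set" and \<epsilon> :: real
  assumes "finite T" "T \<subseteq> S" "finite F" "0 < \<epsilon>"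
  shows "\<exists>l. finite l \<and> F \<subseteq> l \<and> (\<forall>a\<in>T. \<forall>b\<in>T. C (Neg b) b \<noteq> 1 \<longrightarrow>
    \<bar>real (card ((ext a \<inter> ext b) \<times> UNIV \<inter> l)) / real (card (ext b \<times> UNIV \<inter> l)) - C a b\<bar> < \<epsilon>)"
proof (cases "T = {}")
  \<comment> \<open>This also covers an empty \<open>S\<close>, where no algebra is
    available.\<close>
  case True
  then show ?thesis using assms(3) by (intro exI[of _ F]) auto
next
  case False
  then interpret popper_algebra "ext ` S" set_C
    using assms(2) by (intro popper_algebra_ext) auto
  obtain l where l: "finite l" "F \<subseteq> l"
    and approx: "\<forall>A\<in>ext ` T. \<forall>B\<in>ext ` T. set_C (- B) B \<noteq> 1 \<longrightarrow>
      \<bar>real (card ((A \<inter> B) \<times> UNIV \<inter> l)) / real (card (B \<times> UNIV \<inter> l)) - set_C (A \<inter> B) B\<bar> < \<epsilon>"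
    using finite_set_approximation[of "ext ` T" F \<epsilon>] assms image_mono[OF assms(2), of ext]
    by (metis finite_imageI)
  have "\<bar>real (card ((ext a \<inter> ext b) \<times> UNIV \<inter> l)) / real (card (ext b \<times> UNIV \<inter> l)) - C a b\<bar> < \<epsilon>"
    if ab: "a \<in> T" "b \<in> T" "C (Neg b) b \<noteq> 1" for a b
  proof -
    have S: "a \<in> S" "b \<in> S" using ab assms(2) by auto
    then have "set_C (- ext b) (ext b) = C (Neg b) b" "set_C (ext a \<inter> ext b) (ext b) = C a b"
      by (simp_all add: set_C_simps C_Conj_right)
    then show ?thesis
      using approx[rule_format, OF imageI[OF ab(1)] imageI[OF ab(2)]] ab(3) by simp
  qed
  with l show ?thesis by blast
qed

lemma popper_to_nap:
  "\<exists>(\<Omega> :: (('p \<Rightarrow> bool) \<times> nat) set) \<Lambda> U w J.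
     nap_space \<Omega> \<Lambda> U w \<and>
     interpretation_in (form_language S) \<Omega> J \<and>
     nap_regular \<Omega> U w \<and>
     (\<forall>a\<in>S. \<forall>b\<in>S. C (Neg b) b \<noteq> 1 \<longrightarrow>
        J b \<noteq> {} \<and>
        C a b = st U (hdivide U (nap_prob U w (J a \<inter> J b)) (nap_prob U w (J b))))"
proof -
  \<comment> \<open>The second coordinate gives each valuation infinitely many copies; it also makes
    the sample space infinite.\<close>
  define J where "J a = ext a \<times> (UNIV :: nat set)" for a
  define w :: "('p \<Rightarrow> bool) \<times> nat \<Rightarrow> real" where "w = (\<lambda>_. 1)"
  \<comment> \<open>A triple \<open>(F, T, n)\<close> is a demand: contain the points
    \<open>F\<close> and approximate \<open>C\<close> on the sentences \<open>T\<close> within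
    \<open>1 / (n + 1)\<close>. The function \<open>g\<close> chooses a set that meets it.\<close>
  define good where "good F T n l \<longleftrightarrow> finite l \<and> F \<subseteq> l \<and> (\<forall>a\<in>T. \<forall>b\<in>T. C (Neg b) b \<noteq> 1 \<longrightarrow>
    \<bar>real (card (J a \<inter> J b \<inter> l)) / real (card (J b \<inter> l)) - C a b\<bar> < 1 / real (Suc n))"
    for F l T n
  define g where "g = (\<lambda>(F, T, n). SOME l. good F T n l)"
  have g: "good F T n (g (F, T, n))" if "finite F" "finite T" "T \<subseteq> S" for F T n
  proof -
    have "\<exists>l. good F T n l"
      using finite_approximation[OF that(2,3,1), of "1 / real (Suc n)"]
      unfolding good_def J_def Times_Int_distrib1 by simp
    then show ?thesis unfolding g_def prod.case by (rule someI_ex)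
  qed
  \<comment> \<open>\<open>G\<close> describes ever stricter demands, and its image under
    \<open>g\<close> is a proper filter of approximating sets. By \<open>U_I\<close> below, whatever
    all sufficiently strict demands ensure is eventual in \<open>U\<close>.\<close>
  define G where "G = finite_subsets_at_top (UNIV :: (('p \<Rightarrow> bool) \<times> nat) set) \<times>\<^sub>F
    (finite_subsets_at_top S \<times>\<^sub>F sequentially)"
  have "filtermap g G \<noteq> bot"
    by (simp add: G_def filtermap_bot_iff prod_filter_eq_bot)
  then obtain U where U: "U \<le> filtermap g G" "U \<noteq> bot"
      "\<And>Q. (\<forall>\<^sub>F l in U. Q l) \<or> (\<forall>\<^sub>F l in U. \<not> Q l)"
    by (rule ultrafilter_below) blast
  have U_I: "\<forall>\<^sub>F l in U. P l"
    if F0: "finite F0" and T0: "finite T0" "T0 \<subseteq> S"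
      and P: "\<And>F T n. F0 \<subseteq> F \<Longrightarrow> T0 \<subseteq> T \<Longrightarrow> n0 \<le> n \<Longrightarrow> good F T n (g (F, T, n)) \<Longrightarrow> P (g (F, T, n))"
    for F0 T0 n0 P
  proof -
    have "\<forall>\<^sub>F F in finite_subsets_at_top UNIV. finite F \<and> F0 \<subseteq> F"
      using F0 by (auto simp: eventually_finite_subsets_at_top)
    moreover have "\<forall>\<^sub>F T in finite_subsets_at_top S. finite T \<and> T0 \<subseteq> T \<and> T \<subseteq> S"
      using T0 by (auto simp: eventually_finite_subsets_at_top)
    ultimately have "\<forall>\<^sub>F x in G. (finite (fst x) \<and> F0 \<subseteq> fst x) \<and>
        (finite (fst (snd x)) \<and> T0 \<subseteq> fst (snd x) \<and> fst (snd x) \<subseteq> S) \<and> n0 \<le> snd (snd x)"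
      unfolding G_def by (intro eventually_prodI eventually_ge_at_top)
    then have "\<forall>\<^sub>F x in G. P (g x)"
      by eventually_elim (use P g in auto)
    then show ?thesis using U(1) by (simp add: le_filter_def eventually_filtermap)
  qed
  have fin: "\<forall>\<^sub>F l in U. finite l"
    by (rule U_I[of "{}" "{}" 0]) (auto simp: good_def)
  have fine: "\<forall>\<^sub>F l in U. x \<in> l" for x
    by (rule U_I[of "{x}" "{}" 0]) (auto simp: good_def)
  have inf: "infinite (UNIV :: (('p \<Rightarrow> bool) \<times> nat) set)"
    by (simp add: finite_prod)
  have "free_filter U"
    unfolding free_filter_def
  proof
    fix k :: "(('p \<Rightarrow> bool) \<times> nat) set"
    show "\<forall>\<^sub>F l in U. l \<noteq> k"
    \<comment> \<open>A finite \<open>k\<close> misses a point that eventually lies in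
      \<open>l\<close>; an infinite \<open>k\<close> is avoided because \<open>l\<close> is
      eventually finite.\<close>
    proof (cases "finite k")
      case True
      then obtain x where "x \<notin> k" using inf by (metis ex_new_if_finite)
      then show ?thesis using fine[of x] by (auto elim: eventually_mono)
    next
      case False
      then show ?thesis using fin by (auto elim: eventually_mono)
    qed
  qed
  moreover have "\<exists>m\<in>Collect finite. k \<subseteq> m \<and> l \<subseteq> m"
    if "k \<in> Collect finite" "l \<in> Collect finite" for k l :: "(('p \<Rightarrow> bool) \<times> nat) set"
    using that by (intro bexI[of _ "k \<union> l"]) auto
  ultimately have nap: "nap_space UNIV (Collect finite) U w"
    unfolding nap_space_def ultrafilter_on_def using U(2,3) fin fine
    by (auto simp: w_def)
  have reg: "nap_regular UNIV U w"
    unfolding nap_regular_def hreal_def nap_prob_def hless_hclass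
  proof (intro allI impI, elim conjE)
    fix A :: "(('p \<Rightarrow> bool) \<times> nat) set" assume "A \<noteq> {}"
    then obtain x where "x \<in> A" by blast
    show "\<forall>\<^sub>F l in U. 0 < cond_prob w A l"
      using fin fine[of x]
    proof eventually_elim
      case (elim l)
      then have "0 < card (A \<inter> l)" "0 < card l"
        using \<open>x \<in> A\<close> by (auto simp: card_gt_0_iff)
      then show ?case by (simp add: cond_prob_def w_def)
    qed
  qed
  have int: "interpretation_in (form_language S) UNIV J"
    unfolding interpretation_in_def log_equiv_iff
    by (auto simp: J_def form_language_def tautology_def contradiction_def ext_def)
  have "J b \<noteq> {} \<and> C a b = st U (hdivide U (nap_prob U w (J a \<inter> J b)) (nap_prob U w (J b)))"
    if ab: "a \<in> S" "b \<in> S" and normal: "C (Neg b) b \<noteq> 1" for a b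
  proof
    show "J b \<noteq> {}" using normal_satisfiable[OF ab(2) normal] by (simp add: J_def)
    have "((\<lambda>l. cond_prob w (J a \<inter> J b) l / cond_prob w (J b) l) \<longlongrightarrow> C a b) U"
    proof (rule tendstoI)
      fix \<epsilon> :: real assume "0 < \<epsilon>"
      then obtain n0 where n0: "1 / real (Suc n0) < \<epsilon>" using nat_approx_posE by blast
      have "\<forall>\<^sub>F l in U. \<bar>real (card (J a \<inter> J b \<inter> l)) / real (card (J b \<inter> l)) - C a b\<bar> < \<epsilon>"
      proof (rule U_I[of "{}" "{a, b}" n0])
        \<comment> \<open>Only demands that mention \<open>a\<close> and \<open>b\<close> with
          tolerance at most \<open>1 / (n0 + 1)\<close> are considered.\<close>
        fix F T n assume T: "{a, b} \<subseteq> T" and n: "n0 \<le> n" and "good F T n (g (F, T, n))"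
        then have "\<bar>real (card (J a \<inter> J b \<inter> g (F, T, n))) / real (card (J b \<inter> g (F, T, n))) - C a b\<bar>
            < 1 / real (Suc n)"
          using normal by (auto simp: good_def)
        also have "\<dots> \<le> 1 / real (Suc n0)" using n by (simp add: frac_le)
        finally show "\<bar>real (card (J a \<inter> J b \<inter> g (F, T, n))) / real (card (J b \<inter> g (F, T, n))) - C a b\<bar> < \<epsilon>"
          using n0 by simp
      qed (use ab in auto)
      \<comment> \<open>The arbitrary point \<open>undefined\<close> makes \<open>l\<close>
        eventually nonempty, so the total weight \<open>card l\<close> cancels and the ratio of
        counts remains.\<close>
      then show "\<forall>\<^sub>F l in U. dist (cond_prob w (J a \<inter> J b) l / cond_prob w (J b) l) (C a b) < \<epsilon>"
        using fin fine[of undefined]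
      proof eventually_elim
        case (elim l)
        then have "card l \<noteq> 0" by auto
        with elim show ?case by (simp add: cond_prob_def w_def dist_real_def)
      qed
    qed
    then show "C a b = st U (hdivide U (nap_prob U w (J a \<inter> J b)) (nap_prob U w (J b)))"
      using st_nap_quotient[OF U(2)] by metis
  qed
  with nap reg int show ?thesis by blast
qed

end

theorem theorem1:
  shows
    "(\<forall>(S :: 'p form set) (C :: 'p form \<Rightarrow> 'p form \<Rightarrow> real).
        closed_forms S \<and> popper_function (form_language S) C \<longrightarrow>
        (\<exists>(\<Omega> :: (('p \<Rightarrow> bool) \<times> nat) set) \<Lambda> U w J.
           nap_space \<Omega> \<Lambda> U w \<and>
           interpretation_in (form_language S) \<Omega> J \<and>
           nap_regular \<Omega> U w \<and>
           (\<forall>a\<in>S. \<forall>b\<in>S. C (Neg b) b \<noteq> 1 \<longrightarrow>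
              J b \<noteq> {} \<and>
              C a b = st U (hdivide U (nap_prob U w (J a \<inter> J b)) (nap_prob U w (J b)))))) \<and>
     (\<forall>(\<Omega> :: 'w set) \<Lambda> U w.
        nap_space \<Omega> \<Lambda> U w \<and> nap_regular \<Omega> U w \<longrightarrow>
        (\<exists>C. popper_function (subset_language \<Omega>) C \<and>
           (\<forall>A B. A \<subseteq> \<Omega> \<and> B \<subseteq> \<Omega> \<and> A \<noteq> {} \<longrightarrow>
              C B A = st U (hdivide U (nap_prob U w (B \<inter> A)) (nap_prob U w A)))))"
proof (intro conjI allI impI; elim conjE)
  fix S :: "'p form set" and C
  assume "closed_forms S" "popper_function (form_language S) C"
  then interpret form_popper S C by unfold_locales
  show "\<exists>(\<Omega> :: (('p \<Rightarrow> bool) \<times> nat) set) \<Lambda> U w J.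
           nap_space \<Omega> \<Lambda> U w \<and>
           interpretation_in (form_language S) \<Omega> J \<and>
           nap_regular \<Omega> U w \<and>
           (\<forall>a\<in>S. \<forall>b\<in>S. C (Neg b) b \<noteq> 1 \<longrightarrow>
              J b \<noteq> {} \<and>
              C a b = st U (hdivide U (nap_prob U w (J a \<inter> J b)) (nap_prob U w (J b))))"
    by (rule popper_to_nap)
qed (rule nap_to_popper)

end
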